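(* Let $q$ be a power of an odd prime, let $n\ge 1$, and consider a conjugacy class of $\mathrm{Sp}(2n,\mathbb{F}_q)$. If, for some even integer $2i>0$, either $(t-1)^{2i}$ or $(t+1)^{2i}$ occurs with odd multiplicity as an elementary divisor of the elements of this class, then this conjugacy class is not strongly real in $\mathrm{Sp}(2n,\mathbb{F}_q)$.
   Context: $\mathrm{Sp}(2n,\mathbb{F}_q)$ is the isometry group of a non-degenerate alternating bilinear form on a $2n$-dimensional $\mathbb{F}_q$-vector space. An element $g$ of a group $G$ is strongly real in $G$ if there is $s\in G$ with $s^2=1$ and $sgs=g^{-1}$; a conjugacy class is strongly real if its elements are. The multiplicity of $(t\mp1)^{k}$ as an elementary divisor of $g$ is the number of Jordan blocks of $g$ of size $k$ with eigenvalue $\pm 1$. *)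

theory Defs
  imports
    "HOL-Algebra.Algebraic_Closure_Type"
    "HOL-Algebra.Group_Action"
    "Jordan_Normal_Form.Jordan_Normal_Form_Existence"
    "Jordan_Normal_Form.Jordan_Normal_Form_Uniqueness"
    "Jordan_Normal_Form.DL_Rank"
begin

text \<open>Vectors and matrices are those of \<open>Jordan_Normal_Form.Matrix\<close>: the space of column vectors
  of length \<open>m\<close> is \<open>carrier_vec m\<close>, and a form is only constrained on these vectors.\<close>

definition bilinear_form :: "nat \<Rightarrow> ('a::field vec \<Rightarrow> 'a vec \<Rightarrow> 'a) \<Rightarrow> bool" where
  "bilinear_form m B \<longleftrightarrow>
     (\<forall>u\<in>carrier_vec m. \<forall>v\<in>carrier_vec m. \<forall>w\<in>carrier_vec m.
        B (u + v) w = B u w + B v w \<and> B u (v + w) = B u v + B u w) \<and>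
     (\<forall>c. \<forall>v\<in>carrier_vec m. \<forall>w\<in>carrier_vec m.
        B (c \<cdot>\<^sub>v v) w = c * B v w \<and> B v (c \<cdot>\<^sub>v w) = c * B v w)"

definition alternating_form :: "nat \<Rightarrow> ('a::field vec \<Rightarrow> 'a vec \<Rightarrow> 'a) \<Rightarrow> bool" where
  "alternating_form m B \<longleftrightarrow> bilinear_form m B \<and> (\<forall>v\<in>carrier_vec m. B v v = 0)"

definition nondegenerate_form :: "nat \<Rightarrow> ('a::field vec \<Rightarrow> 'a vec \<Rightarrow> 'a) \<Rightarrow> bool" where
  "nondegenerate_form m B \<longleftrightarrow>
     (\<forall>v\<in>carrier_vec m. (\<forall>w\<in>carrier_vec m. B v w = 0) \<longrightarrow> v = 0\<^sub>v m) \<and>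
     (\<forall>w\<in>carrier_vec m. (\<forall>v\<in>carrier_vec m. B v w = 0) \<longrightarrow> w = 0\<^sub>v m)"

definition isometry_group :: "nat \<Rightarrow> ('a::field vec \<Rightarrow> 'a vec \<Rightarrow> 'a) \<Rightarrow> 'a mat monoid" where
  "isometry_group m B =
     \<lparr>carrier = {g \<in> carrier_mat m m. invertible_mat g \<and>
        (\<forall>v\<in>carrier_vec m. \<forall>w\<in>carrier_vec m. B (g *\<^sub>v v) (g *\<^sub>v w) = B v w)},
      monoid.mult = (*), one = 1\<^sub>m m\<rparr>"

lemma invertible_mat_iff_Units:
  fixes g :: "'a::field mat"
  assumes g: "g \<in> carrier_mat m m"
  shows "invertible_mat g \<longleftrightarrow> g \<in> Units (ring_mat TYPE('a) m ())"
proof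
  assume "invertible_mat g"
  then obtain h where "inverts_mat g h" "inverts_mat h g"
    by (auto simp: invertible_mat_def)
  moreover from this have "h \<in> carrier_mat m m"
    using g unfolding inverts_mat_def
    by (metis carrier_matD carrier_matI index_mult_mat(2,3) index_one_mat(2,3))
  ultimately show "g \<in> Units (ring_mat TYPE('a) m ())"
    using g by (auto simp: inverts_mat_def Units_def ring_mat_def)
next
  assume "g \<in> Units (ring_mat TYPE('a) m ())"
  then show "invertible_mat g"
    by (auto simp: invertible_mat_def inverts_mat_def Units_def ring_mat_def)
qed

lemma group_isometry_group: "group (isometry_group m B)"
proof (rule groupI)
  fix g assume "g \<in> carrier (isometry_group m B)"
  then have g: "g \<in> carrier_mat m m" and "invertible_mat g"
    and iso: "\<And>v w. v \<in> carrier_vec m \<Longrightarrow> w \<in> carrier_vec m \<Longrightarrow> B (g *\<^sub>v v) (g *\<^sub>v w) = B v w"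
    by (auto simp: isometry_group_def)
  then obtain h where h: "h \<in> carrier_mat m m" and gh: "g * h = 1\<^sub>m m" and hg: "h * g = 1\<^sub>m m"
    using invertible_mat_iff_Units[OF g] by (auto simp: Units_def ring_mat_def)
  have "B (h *\<^sub>v v) (h *\<^sub>v w) = B v w" if v: "v \<in> carrier_vec m" and w: "w \<in> carrier_vec m" for v w
  proof -
    have "g *\<^sub>v (h *\<^sub>v x) = x" if "x \<in> carrier_vec m" for x
      using assoc_mult_mat_vec[OF g h that] gh that by simp
    with iso[of "h *\<^sub>v v" "h *\<^sub>v w"] v w h show ?thesis by simp
  qed
  moreover have "invertible_mat h"
    using h g gh hg unfolding invertible_mat_def inverts_mat_def by auto
  ultimately show "\<exists>y\<in>carrier (isometry_group m B).
      y \<otimes>\<^bsub>isometry_group m B\<^esub> g = \<one>\<^bsub>isometry_group m B\<^esub>"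
    using h hg by (auto simp: isometry_group_def)
next
  fix g h assume "g \<in> carrier (isometry_group m B)" "h \<in> carrier (isometry_group m B)"
  moreover have "invertible_mat (g * h)"
    if gh: "g \<in> carrier_mat m m" "h \<in> carrier_mat m m" and inv: "invertible_mat g" "invertible_mat h"
  proof -
    interpret R: ring "ring_mat TYPE('a) m ()" by (rule ring_mat)
    show ?thesis
      using R.Units_m_closed[of g h] gh inv
      by (simp add: invertible_mat_iff_Units[of _ m] ring_mat_simps)
  qed
  ultimately show "g \<otimes>\<^bsub>isometry_group m B\<^esub> h \<in> carrier (isometry_group m B)"
    by (auto simp: isometry_group_def assoc_mult_mat_vec[of _ m m _ m])
qed (auto simp: isometry_group_def invertible_mat_def inverts_mat_def intro!: exI[of _ "1\<^sub>m m"])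

definition conjugacy_classes :: "('g, 'x) monoid_scheme \<Rightarrow> 'g set set" where
  "conjugacy_classes G =
     orbits G (carrier G) (\<lambda>g. \<lambda>h\<in>carrier G. g \<otimes>\<^bsub>G\<^esub> h \<otimes>\<^bsub>G\<^esub> inv\<^bsub>G\<^esub> g)"

definition strongly_real :: "('g, 'x) monoid_scheme \<Rightarrow> 'g \<Rightarrow> bool" where
  "strongly_real G g \<longleftrightarrow> g \<in> carrier G \<and>
     (\<exists>s\<in>carrier G. s \<otimes>\<^bsub>G\<^esub> s = \<one>\<^bsub>G\<^esub> \<and> s \<otimes>\<^bsub>G\<^esub> g \<otimes>\<^bsub>G\<^esub> s = inv\<^bsub>G\<^esub> g)"

definition strongly_real_class :: "('g, 'x) monoid_scheme \<Rightarrow> 'g set \<Rightarrow> bool" where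
  "strongly_real_class G C \<longleftrightarrow> (\<forall>g\<in>C. strongly_real G g)"

text \<open>\<open>elem_divisor_mult A c k\<close> is the multiplicity of \<open>(t - c)\<^sup>k\<close> as an elementary divisor of the
  square matrix \<open>A\<close>, i.e. the number of Jordan blocks of size \<open>k\<close> with eigenvalue \<open>c\<close>. Jordan
  normal forms are taken over the algebraic closure, because the characteristic polynomial need
  not split over the ground field. The choice of the normal form is immaterial by
  \<open>elem_divisor_mult_eq\<close> below, and a normal form exists by \<open>jordan_nf_to_ac_exists\<close>.\<close>

definition elem_divisor_mult :: "'a::field mat \<Rightarrow> 'a \<Rightarrow> nat \<Rightarrow> nat" where
  "elem_divisor_mult A c k =
     count_list (SOME js. jordan_nf (map_mat to_ac A) js) (k, to_ac c)"

lemma triangularizable: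
  fixes A :: "'a::alg_closed_field mat"
  assumes "A \<in> carrier_mat n n"
  shows "\<exists>C\<in>carrier_mat n n. upper_triangular C \<and> similar_mat A C"
  using assms
proof (induction n arbitrary: A)
  case 0
  then show ?case by (intro bexI[of _ A]) (auto intro: similar_mat_refl)
next
  case (Suc n A)
  let ?n = "Suc n"
  note A = Suc.prems
  have "degree (char_poly A) = ?n"
    using degree_monic_char_poly[OF A] by simp
  then obtain e where "poly (char_poly A) e = 0"
    using alg_closed_imp_poly_has_root[of "char_poly A"] by auto
  then have "eigenvalue A e"
    using eigenvalue_root_char_poly[OF A] by simp
  then obtain v where v: "v \<in> carrier_vec ?n" and v0: "v \<noteq> 0\<^sub>v ?n" and Av: "A *\<^sub>v v = e \<cdot>\<^sub>v v"
    using A by (auto simp: eigenvalue_def eigenvector_def)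
  have unit: "M *\<^sub>v unit_vec ?n 0 = col M 0" if "M \<in> carrier_mat ?n ?n" for M :: "'a mat"
    using that by (intro eq_vecI) auto
  interpret vec_space "TYPE('a)" ?n .
  define b where "b = basis_completion v"
  note bc = basis_completion[OF v v0, folded b_def]
  define W where "W = mat_of_cols ?n b"
  have W: "W \<in> carrier_mat ?n ?n"
    using bc(6) unfolding W_def by auto
  have cols: "cols W = b"
    unfolding W_def by (rule cols_mat_of_cols[OF bc(2)])
  have "rank W = ?n"
    using lin_indpt_full_rank[OF W] bc(4,5) cols by simp
  then have "det W \<noteq> 0"
    using det_rank_iff[OF W] by simp
  then obtain W' where W': "W' \<in> carrier_mat ?n ?n" and WW': "W * W' = 1\<^sub>m ?n" "W' * W = 1\<^sub>m ?n"
    using det_non_zero_imp_unit[OF W, of b] by (auto simp: Units_def ring_mat_def)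
  define A' where "A' = W' * A * W"
  have A': "A' \<in> carrier_mat ?n ?n"
    using W W' A by (auto simp: A'_def)
  have simAA': "similar_mat A A'"
  proof (rule similar_mat_sym, rule similar_matI)
    show "A' = W' * A * W" by (rule A'_def)
  qed (use A A' W W' WW' in auto)
  have Wcol: "col W 0 = v"
    using bc(6,7) cols W
    by (metis carrier_matD(2) cols_nth hd_conv_nth length_0_conv nat.distinct(1) zero_less_Suc)
  have Wu: "W *\<^sub>v unit_vec ?n 0 = v"
    using unit[OF W] Wcol by simp
  then have W'v: "W' *\<^sub>v v = unit_vec ?n 0"
    using assoc_mult_mat_vec[OF W' W, of "unit_vec ?n 0"] WW' Wu by simp
  have "col A' 0 = A' *\<^sub>v unit_vec ?n 0"
    using unit[OF A'] by simp
  also have "\<dots> = W' *\<^sub>v (A *\<^sub>v (W *\<^sub>v unit_vec ?n 0))"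
    using W W' A by (simp add: A'_def assoc_mult_mat_vec[of _ ?n ?n _ ?n])
  also have "\<dots> = e \<cdot>\<^sub>v unit_vec ?n 0"
    using Wu Av W'v mult_mat_vec[OF W' v] by simp
  finally have col0: "col A' 0 = e \<cdot>\<^sub>v unit_vec ?n 0" .
  obtain A1 A2 A0 A3 where split: "split_block A' 1 1 = (A1, A2, A0, A3)"
    by (cases "split_block A' 1 1") auto
  have "dim_row A' = 1 + n" "dim_col A' = 1 + n" using A' by auto
  note sb = split_block[OF split this]
  have A0: "A0 = 0\<^sub>m n 1"
  proof (rule eq_matI)
    fix i j assume "i < dim_row (0\<^sub>m n 1)" "j < dim_col (0\<^sub>m n 1)"
    then have i: "i < n" and j: "j = 0" by auto
    have "A0 $$ (i, 0) = A' $$ (Suc i, 0)"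
      using split A' i by (auto simp: split_block_def Let_def)
    also have "\<dots> = col A' 0 $ Suc i" using A' i by simp
    also have "\<dots> = 0" unfolding col0 using i by simp
    finally show "A0 $$ (i, j) = 0\<^sub>m n 1 $$ (i, j)" using i j by simp
  qed (use sb in auto)
  obtain C where C: "C \<in> carrier_mat n n" "upper_triangular C" "similar_mat A3 C"
    using Suc.IH[OF sb(4)] by blast
  have A': "A' = four_block_mat A1 A2 (0\<^sub>m n 1) A3"
    using sb(5) A0 by simp
  obtain A2' where A2': "A2' \<in> carrier_mat 1 n"
    and sim: "similar_mat A' (four_block_mat A1 A2' (0\<^sub>m n 1) C)"
    using similar_mat_four_block_0_ex[OF similar_mat_refl[OF sb(1)] C(3) sb(2) sb(1) sb(4), folded A']
    by auto
  show ?case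
  proof (intro bexI conjI)
    show "upper_triangular (four_block_mat A1 A2' (0\<^sub>m n 1) C)"
      by (rule upper_triangular_four_block[OF sb(1) C(1) _ C(2)]) (use sb(1) in auto)
    show "similar_mat A (four_block_mat A1 A2' (0\<^sub>m n 1) C)"
      using similar_mat_trans[OF simAA' sim] .
    show "four_block_mat A1 A2' (0\<^sub>m n 1) C \<in> carrier_mat ?n ?n"
      using four_block_carrier_mat[OF sb(1) C(1)] by simp
  qed
qed

lemma jordan_nf_to_ac_exists:
  assumes "A \<in> carrier_mat n n"
  shows "\<exists>js. jordan_nf (map_mat to_ac A) js"
proof -
  have "map_mat to_ac A \<in> carrier_mat n n" using assms by simp
  from triangularizable[OF this] obtain C where
    C: "C \<in> carrier_mat n n" "upper_triangular C" "similar_mat (map_mat to_ac A) C" by blast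
  from triangular_to_jnf_vector[OF C(1,2)] similar_mat_trans[OF C(3)] show ?thesis
    unfolding jordan_nf_def by blast
qed

lemma elem_divisor_mult_eq:
  assumes js: "jordan_nf (map_mat to_ac A) js"
  shows "elem_divisor_mult A c k = count_list js (k, to_ac c)"
proof -
  define js' where "js' = (SOME js. jordan_nf (map_mat to_ac A) js)"
  have js': "jordan_nf (map_mat to_ac A) js'"
    unfolding js'_def using js by (rule someI)
  have "count_list js' (k, to_ac c) = count_list js (k, to_ac c)"
  proof (cases "k = 0")
    case True
    have "(0, x) \<notin> set l" if "jordan_nf (map_mat to_ac A) l" for l x
      using that unfolding jordan_nf_def by force
    with True js js' show ?thesis by simp
  next
    case False
    have "count_list l x = length (filter ((=) x) l)" for l :: "(nat \<times> 'a alg_closure) list" and x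
      by (induction l) auto
    with compute_nr_of_jordan_blocks[OF js False] compute_nr_of_jordan_blocks[OF js' False]
    show ?thesis by metis
  qed
  then show ?thesis unfolding elem_divisor_mult_def js'_def .
qed

end

theory Submission
  imports Defs
begin

text \<open>
  Write \<open>G\<close> for the matrix of an isometry, \<open>J\<close> for the Gram matrix of the alternating form and let
  \<open>S\<close> be an isometric involution with \<open>S G S = G\<^sup>-\<^sup>1\<close>. Let \<open>c = 1\<close> or \<open>c = - 1\<close>. The number of Jordan
  blocks of size \<open>k\<close> and eigenvalue \<open>c\<close> is
  \<open>2 d\<^sub>k - d\<^sub>k\<^sub>-\<^sub>1 - d\<^sub>k\<^sub>+\<^sub>1\<close> with \<open>d\<^sub>j = dim ker (G - c)\<^sup>j\<close>, so for even \<open>k\<close> its parity is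
  controlled by \<open>d\<^sub>j\<close> for odd \<open>j\<close> only, and it suffices that all \<open>d\<^sub>j\<close> with \<open>j\<close> odd have the same
  parity.

  The key observation (\<open>even_kernel_dim_skew\<close>) is that a matrix \<open>M\<close> which is skew-adjoint for the
  form and also anticommutes with \<open>S\<close> has even nullity. Indeed the space is the orthogonal sum of
  the eigenspaces \<open>V\<^sub>+\<close> and \<open>V\<^sub>-\<close> of \<open>S\<close>, and \<open>M\<close> interchanges them. The two components
  \<open>V\<^sub>+ \<rightarrow> V\<^sub>-\<close> and \<open>V\<^sub>- \<rightarrow> V\<^sub>+\<close> of \<open>M\<close> are adjoint to each other up to sign, so they have the same
  rank, and the rank of \<open>M\<close> is twice that number. The dimension is even too.

  Such matrices are found among the Laurent polynomials in \<open>G\<close>: taking the adjoint and conjugating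
  with \<open>S\<close> both replace \<open>G\<close> by its inverse, so both requirements say that \<open>M\<close> changes sign
  under \<open>G \<mapsto> G\<^sup>-\<^sup>1\<close>. Examples are \<open>M = (G - G\<^sup>-\<^sup>1) (G + G\<^sup>-\<^sup>1 - 2c)\<^sup>l\<close>
  (\<open>skew_laurent_polynomial\<close>), which equals
  \<open>(G + c) (G - c)\<^bsup>2l+1\<^esup>\<close> up to an invertible factor. Since \<open>c \<noteq> - c\<close>, the two factors are
  coprime and the nullity of \<open>M\<close> is \<open>dim ker (G + c) + d\<^sub>2\<^sub>l\<^sub>+\<^sub>1\<close>
  (\<open>kernel_dim_shift_mult_pow\<close>). Hence \<open>d\<^sub>j \<equiv> dim ker (G + c)\<close> modulo 2 for every odd \<open>j\<close>.

  Jordan blocks live over the algebraic closure, so the linear algebra is carried out over an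
  arbitrary field with \<open>2 \<noteq> 0\<close> for matrices satisfying the relations above, and is then applied to the images
  of \<open>G\<close>, \<open>S\<close> and \<open>J\<close> over the closure.
\<close>

section \<open>Nullity of a square matrix\<close>

lemma kernel_dim_mult_invertible:
  fixes A :: "'a::field mat"
  assumes A: "A \<in> carrier_mat n n"
    and U: "U \<in> carrier_mat n n" "U' \<in> carrier_mat n n" "U' * U = 1\<^sub>m n"
    and V: "V \<in> carrier_mat n n" "V' \<in> carrier_mat n n" "V' * V = 1\<^sub>m n"
  shows "kernel_dim (U * A * V) = kernel_dim A"
proof -
  have VV: "V * V' = 1\<^sub>m n" using mat_mult_left_right_inverse[OF V(2,1,3)] .
  have UA: "U * A \<in> carrier_mat n n" using U A by auto
  show ?thesis
    using mat_kernel_dim_mult_eq_right[OF UA V(1,2) VV] mat_kernel_mult_eq[OF A U]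
      A U V by (simp add: kernel_dim_def)
qed

lemma kernel_dim_mult_left:
  fixes A :: "'a::field mat"
  assumes A: "A \<in> carrier_mat n n"
    and U: "U \<in> carrier_mat n n" "U' \<in> carrier_mat n n" "U' * U = 1\<^sub>m n"
  shows "kernel_dim (U * A) = kernel_dim A"
  using mat_kernel_mult_eq[OF A U] A by (simp add: kernel_dim_def)

lemma kernel_dim_block_diag:
  fixes A :: "'a::field mat"
  assumes "A \<in> carrier_mat n n" "B \<in> carrier_mat m m"
  shows "kernel_dim (four_block_mat A (0\<^sub>m n m) (0\<^sub>m m n) B) = kernel_dim A + kernel_dim B"
  using kernel_four_block_0_mat[OF refl assms] assms by (simp add: kernel_dim_def)

lemma kernel_dim_eq_pivots:
  fixes A :: "'a::field mat"
  assumes A: "A \<in> carrier_mat n n"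
  obtains P Q R f where "P \<in> carrier_mat n n" "Q \<in> carrier_mat n n" "Q * P = 1\<^sub>m n"
    "R = P * A" "R \<in> carrier_mat n n" "pivot_fun R f n"
    "kernel_dim A = n - length (pivot_positions R)"
proof -
  let ?R = "gauss_jordan_single A"
  from gauss_jordan_single[OF A refl] obtain P Q where
    *: "?R = P * A" "Q * P = 1\<^sub>m n" "P \<in> carrier_mat n n" "Q \<in> carrier_mat n n"
      "?R \<in> carrier_mat n n" "row_echelon_form ?R" by auto
  then obtain f where "pivot_fun ?R f n" unfolding row_echelon_form_def by auto
  then show ?thesis using that[OF *(3,4,2,1,5)] A by (simp add: kernel_dim_code)
qed

lemma length_pivot_positions_le:
  fixes A :: "'a::field mat"
  assumes A: "A \<in> carrier_mat n n" and f: "pivot_fun A f n"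
    and zero: "\<And>i j. i < n \<Longrightarrow> r \<le> j \<Longrightarrow> j < n \<Longrightarrow> A $$ (i, j) = 0"
  shows "length (pivot_positions A) \<le> r"
proof -
  note pp = pivot_positions[OF A f]
  have dim: "dim_row A = n" using A by auto
  have "f i < r" if i: "i < n" "f i \<noteq> n" for i
  proof (rule ccontr)
    assume "\<not> f i < r"
    then have "A $$ (i, f i) = 0"
      using zero[of i "f i"] pivot_funD(1)[OF dim f] i by force
    moreover have "A $$ (i, f i) = 1"
      using pivot_funD(1,4)[OF dim f] i by force
    ultimately show False by simp
  qed
  then have "set (map snd (pivot_positions A)) \<subseteq> {..<r}" using pp(1) by auto
  from card_mono[OF _ this] distinct_card[OF pp(3)] show ?thesis by simp
qed

lemma zero_rows_beyond_pivots:
  fixes A :: "'a::field mat"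
  assumes A: "A \<in> carrier_mat n n" and f: "pivot_fun A f n"
    and i: "length (pivot_positions A) \<le> i" "i < n" and j: "j < n"
  shows "A $$ (i, j) = 0"
proof (rule ccontr)
  assume ne: "A $$ (i, j) \<noteq> 0"
  have dim: "dim_row A = n" using A by auto
  note pp = pivot_positions[OF A f]
  have "f i' \<noteq> n" if "i' \<le> i" for i'
  proof
    assume eq: "f i' = n"
    have "f l = n" if "i' \<le> l" "l < n" for l
      using that
    proof (induction l rule: dec_induct)
      case base show ?case by (rule eq)
    next
      case (step l)
      then have "f l = n" "l < n" by auto
      with step show ?case
        using pivot_funD(3)[OF dim f, of l] pivot_funD(1)[OF dim f, of "Suc l"] by force
    qed
    then have "f i = n" using that i by auto
    then show False using pivot_funD(2)[OF dim f, of i j] i j ne by auto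
  qed
  then have "{..i} \<subseteq> set (map fst (pivot_positions A))" using pp(1) i by force
  from card_mono[OF _ this] distinct_card[OF pp(2)] i show False by simp
qed

text \<open>Row operations turn \<open>A\<close> into an echelon matrix with as many nonzero rows as pivots. The
  transpose of that matrix has nonzero entries only in as many columns, so its own echelon form
  cannot have more pivots.\<close>

lemma kernel_dim_transpose_le:
  fixes A :: "'a::field mat"
  assumes A: "A \<in> carrier_mat n n"
  shows "kernel_dim A \<le> kernel_dim A\<^sup>T"
proof -
  obtain P Q R f where P: "P \<in> carrier_mat n n" "Q \<in> carrier_mat n n" "Q * P = 1\<^sub>m n"
    and R: "R = P * A" "R \<in> carrier_mat n n" and f: "pivot_fun R f n"
    and kA: "kernel_dim A = n - length (pivot_positions R)"
    using kernel_dim_eq_pivots[OF A] .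
  have RT: "R\<^sup>T \<in> carrier_mat n n" using R by simp
  obtain P' Q' R' f' where P': "P' \<in> carrier_mat n n" "Q' \<in> carrier_mat n n" "Q' * P' = 1\<^sub>m n"
    and R': "R' = P' * R\<^sup>T" "R' \<in> carrier_mat n n" and f': "pivot_fun R' f' n"
    and kRT: "kernel_dim R\<^sup>T = n - length (pivot_positions R')"
    using kernel_dim_eq_pivots[OF RT] .
  have "length (pivot_positions R') \<le> length (pivot_positions R)"
  proof (rule length_pivot_positions_le[OF R'(2) f'])
    fix i j assume ij: "i < n" "length (pivot_positions R) \<le> j" "j < n"
    have "R' $$ (i, j) = row P' i \<bullet> row R j"
      using ij P' R(2) by (simp add: R'(1))
    also have "row R j = 0\<^sub>v n"
      using zero_rows_beyond_pivots[OF R(2) f ij(2,3)] R(2) ij by (intro eq_vecI) auto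
    finally show "R' $$ (i, j) = 0" using P' ij by simp
  qed
  then have "kernel_dim A \<le> kernel_dim R\<^sup>T" using kA kRT by simp
  also have "R\<^sup>T = A\<^sup>T * P\<^sup>T" using R(1) P A by (simp add: transpose_mult[of _ n n _ n])
  also have "kernel_dim (A\<^sup>T * P\<^sup>T) = kernel_dim A\<^sup>T"
  proof -
    have "P\<^sup>T * Q\<^sup>T = 1\<^sub>m n" using P transpose_mult[OF P(2,1)] by simp
    then show ?thesis
      using mat_kernel_dim_mult_eq_right[of "A\<^sup>T" n n "P\<^sup>T" "Q\<^sup>T"] A P by (simp add: kernel_dim_def)
  qed
  finally show ?thesis .
qed

lemma kernel_dim_transpose:
  fixes A :: "'a::field mat"
  assumes A: "A \<in> carrier_mat n n"
  shows "kernel_dim A\<^sup>T = kernel_dim A"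
  using kernel_dim_transpose_le[OF A] kernel_dim_transpose_le[of "A\<^sup>T" n] A by simp

lemma kernel_dim_one [simp]: "kernel_dim (1\<^sub>m n :: 'a::field mat) = 0"
  using kernel_one_mat(1)[of n] by (simp add: kernel_dim_def)

lemma kernel_dim_zero [simp]: "kernel_dim (0\<^sub>m n n :: 'a::field mat) = n"
proof -
  let ?Z = "0\<^sub>m n n :: 'a mat"
  have f: "pivot_fun ?Z (\<lambda>_. n) n" by (rule pivot_funI) auto
  have Z: "?Z \<in> carrier_mat n n" by simp
  interpret kernel n n ?Z by unfold_locales simp
  have "{i. i < n \<and> row ?Z i \<noteq> 0\<^sub>v n} = {}" by auto
  then have "card {i. i < n \<and> row ?Z i \<noteq> 0\<^sub>v n} = 0" by (simp only: card.empty)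
  moreover have "row_echelon_form ?Z" using f unfolding row_echelon_form_def by auto
  ultimately have "dim = n" using find_base_vectors(6)[of ?Z n n] Z by (simp only: diff_zero)
  then show ?thesis by simp
qed

lemma one_block_mat:
  "four_block_mat (1\<^sub>m n) (0\<^sub>m n n) (0\<^sub>m n n) (1\<^sub>m n) = (1\<^sub>m (n + n) :: 'a::field mat)"
  by (rule eq_matI) auto

lemma add_right_cancel_mat:
  fixes A :: "'a::field mat"
  assumes "A + C = B + C" "A \<in> carrier_mat n m" "B \<in> carrier_mat n m" "C \<in> carrier_mat n m"
  shows "A = B"
proof (rule eq_matI)
  fix i j assume "i < dim_row B" "j < dim_col B"
  then show "A $$ (i, j) = B $$ (i, j)"
    using arg_cong[OF assms(1), of "\<lambda>M. M $$ (i, j)"] assms(2-) by auto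
qed (use assms in auto)

text \<open>The relation \<open>A U + B = 1\<close> is a Bezout identity; it makes \<open>diag(A, B)\<close> equivalent to
  \<open>diag(1, B A)\<close>. The transforming matrices \<open>L\<close> and \<open>R\<close> below are the products of the elementary
  block operations that perform the Euclidean algorithm on the two diagonal blocks, up to a swap of
  the block columns and a sign.\<close>

lemma kernel_dim_coprime_mult:
  fixes A :: "'a::field mat"
  assumes A: "A \<in> carrier_mat n n" and B: "B \<in> carrier_mat n n" and U: "U \<in> carrier_mat n n"
    and AU: "A * U + B = 1\<^sub>m n"
  shows "kernel_dim (B * A) = kernel_dim A + kernel_dim B"
proof -
  let ?I = "1\<^sub>m n :: 'a mat" and ?Z = "0\<^sub>m n n :: 'a mat"
  define E where "E = A * U"
  have E: "E \<in> carrier_mat n n" and EB: "E + B = ?I" using A U AU by (auto simp: E_def)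
  have BE: "B + E = ?I" using EB comm_add_mat[OF E B] by simp
  have "B * E + B * B = E * B + B * B"
    using mult_add_distrib_mat[OF B E B] add_mult_distrib_mat[OF E B B] EB B by simp
  from add_right_cancel_mat[OF this, of n n] have comm: "B * E = E * B" using B E by simp
  have EA: "E * A + B * A = A" using add_mult_distrib_mat[OF E B A] EB A by simp
  have AUA: "A * (U * A) = E * A" using A U by (simp add: E_def)
  have BAU: "B * A * U = B * E" using A B U by (simp add: E_def)
  define D where "D = four_block_mat A ?Z ?Z B"
  define L where "L = four_block_mat ?I ?I (- B) E"
  define L' where "L' = four_block_mat E (- ?I) B ?I"
  define R where "R = four_block_mat U (U * A - ?I) ?I A"
  define R' where "R' = four_block_mat A B (- ?I) U"
  have carr: "D \<in> carrier_mat (n + n) (n + n)" "L \<in> carrier_mat (n + n) (n + n)"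
    "L' \<in> carrier_mat (n + n) (n + n)" "R \<in> carrier_mat (n + n) (n + n)"
    "R' \<in> carrier_mat (n + n) (n + n)"
    using A B U E unfolding D_def L_def L'_def R_def R'_def by auto
  have cancel: "A * (U * A - ?I) + B * A = ?Z"
  proof -
    have "A * (U * A - ?I) = E * A - A"
      using mult_minus_distrib_mat[of A n n "U * A" n ?I] A U AUA by simp
    moreover have "E * A - A + B * A = (E * A + B * A) - A"
      using A B E by (intro eq_matI) auto
    ultimately show ?thesis using EA A by simp
  qed
  have "L' * L = four_block_mat (E * ?I + - ?I * (- B)) (E * ?I + - ?I * E)
      (B * ?I + ?I * (- B)) (B * ?I + ?I * E)"
    unfolding L_def L'_def by (rule mult_four_block_mat[of _ n n _ n _ n _ _ n _ n]) (use B E in auto)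
  also have "\<dots> = 1\<^sub>m (n + n)"
    using B E EB BE by (simp add: one_block_mat minus_add_uminus_mat[symmetric] uminus_l_inv_mat)
  finally have LL: "L' * L = 1\<^sub>m (n + n)" .
  have "R' * R = four_block_mat (A * U + B * ?I) (A * (U * A - ?I) + B * A)
      (- ?I * U + U * ?I) (- ?I * (U * A - ?I) + U * A)"
    unfolding R_def R'_def by (rule mult_four_block_mat[of _ n n _ n _ n _ _ n _ n]) (use A B U in auto)
  also have "\<dots> = 1\<^sub>m (n + n)"
  proof -
    have "- (U * A - ?I) + U * A = ?I" using A U by (intro eq_matI) auto
    moreover have "- ?I * (U * A - ?I) = - (U * A - ?I)" using A U by simp
    ultimately show ?thesis using A B U AU cancel by (simp add: one_block_mat uminus_l_inv_mat)
  qed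
  finally have RR: "R' * R = 1\<^sub>m (n + n)" .
  have "L * D = four_block_mat (?I * A + ?I * ?Z) (?I * ?Z + ?I * B)
      (- B * A + E * ?Z) (- B * ?Z + E * B)"
    unfolding L_def D_def by (rule mult_four_block_mat[of _ n n _ n _ n _ _ n _ n]) (use A B E in auto)
  also have "\<dots> = four_block_mat A B (- (B * A)) (B * E)" using A B E comm by simp
  finally have LD: "L * D = four_block_mat A B (- (B * A)) (B * E)" .
  have "L * D * R = four_block_mat (A * U + B * ?I) (A * (U * A - ?I) + B * A)
      (- (B * A) * U + B * E * ?I) (- (B * A) * (U * A - ?I) + B * E * A)"
    unfolding LD R_def by (rule mult_four_block_mat[of _ n n _ n _ n _ _ n _ n]) (use A B U E in auto)
  also have "\<dots> = four_block_mat ?I ?Z ?Z (B * A)"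
  proof -
    have "B * A * (U * A - ?I) = B * E * A - B * A"
      using mult_minus_distrib_mat[of "B * A" n n "U * A" n ?I] A B U E AUA
      by (simp add: assoc_mult_mat[of _ n n _ n _ n])
    then have "- (B * A) * (U * A - ?I) = - (B * E * A - B * A)" using A B U by simp
    moreover have "- (B * E * A - B * A) + B * E * A = B * A" using A B E by (intro eq_matI) auto
    moreover have "- (B * A) * U + B * E * ?I = ?Z"
      using uminus_l_inv_mat[OF mult_carrier_mat[OF B E]] A B U E BAU by simp
    ultimately show ?thesis using A B U E AU cancel by simp
  qed
  finally have "L * D * R = four_block_mat ?I ?Z ?Z (B * A)" .
  then have "kernel_dim D = kernel_dim (four_block_mat ?I ?Z ?Z (B * A))"
    using kernel_dim_mult_invertible[OF carr(1,2,3) LL carr(4,5) RR] by simp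
  then show ?thesis using A B by (simp add: D_def kernel_dim_block_diag)
qed

text \<open>A matrix that interchanges the ranges of two complementary idempotents is the direct sum of
  its two components. The range of an idempotent is not a coordinate subspace, so the sum is
  formed in twice the dimension: \<open>diag(M, 0)\<close> is equivalent to \<open>diag(Q M, P M)\<close> by means of two
  involutory block matrices.\<close>

lemma kernel_dim_idempotent_split:
  fixes M :: "'a::field mat"
  assumes M: "M \<in> carrier_mat n n" and P: "P \<in> carrier_mat n n" and Q: "Q \<in> carrier_mat n n"
    and PQ: "P + Q = 1\<^sub>m n" and idem: "P * P = P" "Q * Q = Q" and orth: "P * Q = 0\<^sub>m n n" "Q * P = 0\<^sub>m n n"
    and swap: "P * M = M * Q" "Q * M = M * P"
  shows "kernel_dim (P * M) + kernel_dim (Q * M) = kernel_dim M + n"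
proof -
  let ?Z = "0\<^sub>m n n :: 'a mat"
  define D where "D = four_block_mat M ?Z ?Z ?Z"
  define L where "L = four_block_mat Q P P Q"
  define R where "R = four_block_mat P Q Q P"
  have carr: "D \<in> carrier_mat (n + n) (n + n)" "L \<in> carrier_mat (n + n) (n + n)"
    "R \<in> carrier_mat (n + n) (n + n)"
    using M P Q unfolding D_def L_def R_def by auto
  have QP: "Q + P = 1\<^sub>m n" using PQ comm_add_mat[OF P Q] by simp
  have "L * L = four_block_mat (Q * Q + P * P) (Q * P + P * Q) (P * Q + Q * P) (P * P + Q * Q)"
    unfolding L_def by (rule mult_four_block_mat[of _ n n _ n _ n _ _ n _ n]) (use P Q in auto)
  then have LL: "L * L = 1\<^sub>m (n + n)" using PQ QP by (simp add: idem orth one_block_mat)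
  have "R * R = four_block_mat (P * P + Q * Q) (P * Q + Q * P) (Q * P + P * Q) (Q * Q + P * P)"
    unfolding R_def by (rule mult_four_block_mat[of _ n n _ n _ n _ _ n _ n]) (use P Q in auto)
  then have RR: "R * R = 1\<^sub>m (n + n)" using PQ QP by (simp add: idem orth one_block_mat)
  have "L * D = four_block_mat (Q * M + P * ?Z) (Q * ?Z + P * ?Z) (P * M + Q * ?Z) (P * ?Z + Q * ?Z)"
    unfolding L_def D_def by (rule mult_four_block_mat[of _ n n _ n _ n _ _ n _ n]) (use M P Q in auto)
  then have LD: "L * D = four_block_mat (M * P) ?Z (M * Q) ?Z" using M P Q by (simp add: swap)
  have "L * D * R = four_block_mat (M * P * P + ?Z * Q) (M * P * Q + ?Z * P)
      (M * Q * P + ?Z * Q) (M * Q * Q + ?Z * P)"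
    unfolding LD R_def by (rule mult_four_block_mat[of _ n n _ n _ n _ _ n _ n]) (use M P Q in auto)
  also have "\<dots> = four_block_mat (Q * M) ?Z ?Z (P * M)"
    using M P Q by (simp add: assoc_mult_mat[of _ n n _ n _ n] idem orth swap)
  finally have "kernel_dim D = kernel_dim (four_block_mat (Q * M) ?Z ?Z (P * M))"
    using kernel_dim_mult_invertible[OF carr(1,2,2) LL carr(3,3) RR] by simp
  then show ?thesis using M P Q by (simp add: D_def kernel_dim_block_diag)
qed

lemma kernel_dim_smult:
  fixes A :: "'a::field mat"
  assumes A: "A \<in> carrier_mat n n" and w: "w \<noteq> 0"
  shows "kernel_dim (w \<cdot>\<^sub>m A) = kernel_dim A"
proof -
  have "(inverse w \<cdot>\<^sub>m 1\<^sub>m n) * (w \<cdot>\<^sub>m 1\<^sub>m n) = (1\<^sub>m n :: 'a mat)"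
    using w by (intro eq_matI) auto
  moreover have "(w \<cdot>\<^sub>m 1\<^sub>m n) * A = w \<cdot>\<^sub>m A"
    using mult_smult_assoc_mat[of "1\<^sub>m n" n n A n w] A by simp
  ultimately show ?thesis
    using kernel_dim_mult_left[OF A, of "w \<cdot>\<^sub>m 1\<^sub>m n" "inverse w \<cdot>\<^sub>m 1\<^sub>m n"] by simp
qed

lemma pow_mat_commute:
  fixes A :: "'a::field mat"
  assumes A: "A \<in> carrier_mat n n" and B: "B \<in> carrier_mat n n" and AB: "A * B = B * A"
  shows "A * B ^\<^sub>m k = B ^\<^sub>m k * A"
proof (induction k)
  case 0
  show ?case using A B by simp
next
  case (Suc k)
  have Bk: "B ^\<^sub>m k \<in> carrier_mat n n" using B by simp
  have "A * B ^\<^sub>m Suc k = A * B ^\<^sub>m k * B"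
    using A B Bk by (simp add: assoc_mult_mat[of _ n n _ n _ n])
  also have "\<dots> = B ^\<^sub>m k * (A * B)" using A B Bk Suc by (simp add: assoc_mult_mat[of _ n n _ n _ n])
  also have "\<dots> = B ^\<^sub>m Suc k * A" using A B Bk AB by (simp add: assoc_mult_mat[of _ n n _ n _ n])
  finally show ?case .
qed

text \<open>The matrices \<open>N + d\<close> and \<open>N\<^sup>j\<close> are coprime because \<open>d\<close> is invertible. The Bezout identity is
  built by induction on \<open>j\<close> with a scalar cofactor of \<open>N\<^sup>j\<close>, so that only the other cofactor is a
  matrix.\<close>

lemma kernel_dim_shift_mult_pow:
  fixes A :: "'a::field mat"
  assumes N: "N \<in> carrier_mat n n" and A: "A = N + d \<cdot>\<^sub>m 1\<^sub>m n" and d: "d \<noteq> 0"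
  shows "kernel_dim (A * N ^\<^sub>m j) = kernel_dim A + kernel_dim (N ^\<^sub>m j)"
proof -
  have Ac: "A \<in> carrier_mat n n" and pow: "N ^\<^sub>m k \<in> carrier_mat n n" for k using N A by auto
  have "A * N = N * A"
    using N unfolding A
    by (simp add: add_mult_distrib_mat[of _ n n _ _ n] mult_add_distrib_mat[of _ n n _ n]
        mult_smult_assoc_mat[of _ n n _ n] mult_smult_distrib[of _ n n _ n])
  note comm = pow_mat_commute[OF Ac N this]
  have "\<exists>U w. U \<in> carrier_mat n n \<and> w \<noteq> 0 \<and> A * U + w \<cdot>\<^sub>m N ^\<^sub>m j = 1\<^sub>m n"
  proof (induction j)
    case 0
    have "A * 0\<^sub>m n n + 1 \<cdot>\<^sub>m N ^\<^sub>m 0 = 1\<^sub>m n" using Ac N by (intro eq_matI) auto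
    then show ?case by (intro exI[of _ "0\<^sub>m n n"] exI[of _ 1]) auto
  next
    case (Suc j)
    then obtain U w where U: "U \<in> carrier_mat n n" and w: "w \<noteq> 0"
      and eq: "A * U + w \<cdot>\<^sub>m N ^\<^sub>m j = 1\<^sub>m n" by blast
    \<comment> \<open>Substituting \<open>d N\<^sup>j = A N\<^sup>j - N\<^sup>j\<^sup>+\<^sup>1\<close> raises the power of \<open>N\<close> and moves the rest into the
      cofactor of \<open>A\<close>.\<close>
    let ?u = "w / d"
    have "A * N ^\<^sub>m j = N ^\<^sub>m j * N + d \<cdot>\<^sub>m N ^\<^sub>m j"
      using N pow[of j] unfolding comm
      by (simp add: A mult_add_distrib_mat[of _ n n _ n] mult_smult_distrib[of _ n n _ n])
    then have *: "A * N ^\<^sub>m j = N ^\<^sub>m Suc j + d \<cdot>\<^sub>m N ^\<^sub>m j" by simp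
    have "A * (U + ?u \<cdot>\<^sub>m N ^\<^sub>m j) = A * U + ?u \<cdot>\<^sub>m (N ^\<^sub>m Suc j + d \<cdot>\<^sub>m N ^\<^sub>m j)"
      using mult_add_distrib_mat[of A n n U n "?u \<cdot>\<^sub>m N ^\<^sub>m j"]
        mult_smult_distrib[of A n n "N ^\<^sub>m j" n ?u] Ac U pow[of j] * by simp
    moreover have "A * U + ?u \<cdot>\<^sub>m (N ^\<^sub>m Suc j + d \<cdot>\<^sub>m N ^\<^sub>m j) + (- ?u) \<cdot>\<^sub>m N ^\<^sub>m Suc j
        = A * U + w \<cdot>\<^sub>m N ^\<^sub>m j"
    proof -
      have "X1 + ?u \<cdot>\<^sub>m (X2 + d \<cdot>\<^sub>m X3) + (- ?u) \<cdot>\<^sub>m X2 = X1 + w \<cdot>\<^sub>m X3"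
        if "X1 \<in> carrier_mat n n" "X2 \<in> carrier_mat n n" "X3 \<in> carrier_mat n n" for X1 X2 X3
        using that d by (intro eq_matI) (auto simp: field_simps)
      then show ?thesis using mult_carrier_mat[OF Ac U] pow[of j] pow[of "Suc j"] by blast
    qed
    ultimately have "A * (U + ?u \<cdot>\<^sub>m N ^\<^sub>m j) + (- ?u) \<cdot>\<^sub>m N ^\<^sub>m Suc j = 1\<^sub>m n"
      using eq by simp
    moreover have "U + ?u \<cdot>\<^sub>m N ^\<^sub>m j \<in> carrier_mat n n" "- ?u \<noteq> 0"
      using U pow[of j] w d by auto
    ultimately show ?case by blast
  qed
  then obtain U w where U: "U \<in> carrier_mat n n" and w: "w \<noteq> 0"
    and eq: "A * U + w \<cdot>\<^sub>m N ^\<^sub>m j = 1\<^sub>m n" by blast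
  have "(w \<cdot>\<^sub>m N ^\<^sub>m j) * A = w \<cdot>\<^sub>m (A * N ^\<^sub>m j)"
    using mult_smult_assoc_mat[of "N ^\<^sub>m j" n n A n w] pow[of j] Ac comm by simp
  then show ?thesis
    using kernel_dim_coprime_mult[OF Ac _ U eq] pow[of j]
      kernel_dim_smult[OF mult_carrier_mat[OF Ac pow[of j]] w] kernel_dim_smult[OF pow[of j] w]
    by simp
qed

section \<open>Skew-adjoint matrices anticommuting with an isometric involution\<close>

lemma transpose_smult_mat: "(c \<cdot>\<^sub>m A)\<^sup>T = c \<cdot>\<^sub>m A\<^sup>T"
  by (rule eq_matI) auto

text \<open>With \<open>h = 1/2\<close>, the matrix \<open>h (1 + S)\<close> is the projection onto the fixed space of the involution
  \<open>S\<close> along its \<open>- 1\<close>-eigenspace, and \<open>h (1 - S)\<close> is the complementary projection.\<close>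

lemma involution_projection:
  fixes S :: "'a::field mat"
  assumes S: "S \<in> carrier_mat n n" and SS: "S * S = 1\<^sub>m n" and h: "h + h = 1"
  shows "(h \<cdot>\<^sub>m (1\<^sub>m n + S)) * (h \<cdot>\<^sub>m (1\<^sub>m n + S)) = h \<cdot>\<^sub>m (1\<^sub>m n + S)"
    and "(h \<cdot>\<^sub>m (1\<^sub>m n + S)) * (h \<cdot>\<^sub>m (1\<^sub>m n + - S)) = 0\<^sub>m n n"
proof -
  let ?I = "1\<^sub>m n :: 'a mat"
  have smult: "(h \<cdot>\<^sub>m (?I + S)) * (h \<cdot>\<^sub>m B) = (h * h) \<cdot>\<^sub>m ((?I + S) * B)"
    if "B \<in> carrier_mat n n" for B
    using that S mult_smult_assoc_mat[of "?I + S" n n "h \<cdot>\<^sub>m B" n h]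
      mult_smult_distrib[of "?I + S" n n B n h]
    by (simp, intro eq_matI) (auto simp: mult.assoc)
  have "(?I + S) * (?I + S) = (?I + S) + (S + ?I)"
    using S SS add_mult_distrib_mat[of ?I n n S "?I + S" n] mult_add_distrib_mat[of S n n ?I n S] by simp
  moreover have "h * h * (x + y + (y + x)) = h * (x + y)" for x y :: 'a
  proof -
    have "h * h * (x + y + (y + x)) = h * (h + h) * (x + y)" by (simp add: algebra_simps)
    then show ?thesis using h by simp
  qed
  ultimately show "(h \<cdot>\<^sub>m (?I + S)) * (h \<cdot>\<^sub>m (?I + S)) = h \<cdot>\<^sub>m (?I + S)"
    using S smult[of "?I + S"] by (simp, intro eq_matI) auto
  have "S * (?I + - S) = S + - ?I"
    using S SS mult_add_distrib_mat[of S n n ?I n "- S"] by simp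
  then have "(?I + S) * (?I + - S) = (?I + - S) + (S + - ?I)"
    using S add_mult_distrib_mat[of ?I n n S "?I + - S" n] by simp
  also have "\<dots> = 0\<^sub>m n n" using S by (intro eq_matI) auto
  finally show "(h \<cdot>\<^sub>m (?I + S)) * (h \<cdot>\<^sub>m (?I + - S)) = 0\<^sub>m n n"
    using S smult[of "?I + - S"] by simp
qed

text \<open>With \<open>P\<close> and \<open>Q\<close> the projections onto the eigenspaces of \<open>S\<close>, the matrix \<open>J P M\<close> is the
  transpose of \<open>J Q M\<close>: the minus signs coming from \<open>J\<^sup>T = - J\<close> and from skew-adjointness cancel.
  So the two components of \<open>M\<close> have equal nullity.\<close>

lemma even_kernel_dim_skew:
  fixes M :: "'a::field mat"
  assumes two: "(2 :: 'a) \<noteq> 0" and n: "even n"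
    and M: "M \<in> carrier_mat n n" and S: "S \<in> carrier_mat n n" and J: "J \<in> carrier_mat n n"
    and K: "K \<in> carrier_mat n n" "K * J = 1\<^sub>m n"
    and SS: "S * S = 1\<^sub>m n" and SJ: "S\<^sup>T * J = J * S" and JT: "J\<^sup>T = - J"
    and SM: "S * M = - (M * S)" and MJ: "M\<^sup>T * J = - (J * M)"
  shows "even (kernel_dim M)"
proof -
  let ?I = "1\<^sub>m n :: 'a mat"
  define h :: 'a where "h = 1 / 2"
  have h: "h + h = 1" using two by (simp add: h_def field_simps)
  define P where "P = h \<cdot>\<^sub>m (?I + S)"
  define Q where "Q = h \<cdot>\<^sub>m (?I + - S)"
  have P: "P \<in> carrier_mat n n" and Q: "Q \<in> carrier_mat n n" using S by (auto simp: P_def Q_def)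
  have mS: "- S \<in> carrier_mat n n" "(- S) * (- S) = ?I" "- (- S) = S" using S SS by auto
  note proj = involution_projection[OF S SS h, folded P_def Q_def]
    involution_projection[OF mS(1,2) h, unfolded mS(3), folded P_def Q_def]
  have "P + Q = ?I"
  proof -
    have "h * (x + y) + h * (x - y) = x" for x y :: 'a
    proof -
      have "h * (x + y) + h * (x - y) = (h + h) * x" by (simp add: algebra_simps)
      then show ?thesis using h by simp
    qed
    then show ?thesis unfolding P_def Q_def using S by (intro eq_matI) auto
  qed
  have PM: "P * M = M * Q" and QM: "Q * M = M * P"
    using S M SM unfolding P_def Q_def
    by (simp_all add: add_mult_distrib_mat[of _ n n _ _ n] mult_add_distrib_mat[of _ n n _ n]
        mult_smult_assoc_mat[of _ n n _ n] mult_smult_distrib[of _ n n _ n])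
  have PJ: "P\<^sup>T * J = J * P"
    using S J SJ unfolding P_def
    by (simp add: transpose_add[of _ n n] transpose_smult_mat add_mult_distrib_mat[of _ n n _ _ n]
        mult_add_distrib_mat[of _ n n _ n] mult_smult_assoc_mat[of _ n n _ n] mult_smult_distrib[of _ n n _ n])
  have "(J * (P * M))\<^sup>T = M\<^sup>T * P\<^sup>T * - J"
    using J P M JT by (simp add: transpose_mult[of _ n n _ n])
  also have "\<dots> = - (M\<^sup>T * (P\<^sup>T * J))"
    using J P M by (simp add: assoc_mult_mat[of _ n n _ n _ n])
  also have "\<dots> = - (M\<^sup>T * J * P)"
    using J P M PJ by (simp add: assoc_mult_mat[of _ n n _ n _ n])
  also have "\<dots> = J * (Q * M)"
    using J P M MJ QM by (simp add: assoc_mult_mat[of _ n n _ n _ n])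
  finally have "kernel_dim (J * (P * M)) = kernel_dim (J * (Q * M))"
    using kernel_dim_transpose[of "J * (P * M)" n] J P M by simp
  moreover have "kernel_dim (J * (R * M)) = kernel_dim (R * M)" if "R \<in> carrier_mat n n" for R
    using kernel_dim_mult_left[OF _ J K] that M by simp
  ultimately have "kernel_dim (P * M) = kernel_dim (Q * M)" using P Q by simp
  with kernel_dim_idempotent_split[OF M P Q \<open>P + Q = ?I\<close> proj(1,3,2,4) PM QM]
  have "2 * kernel_dim (Q * M) = kernel_dim M + n" by simp
  with n show ?thesis by presburger
qed

section \<open>Parity of the number of Jordan blocks\<close>

text \<open>The witness is \<open>M = (G - H) Z\<^sup>l\<close> with \<open>Z = G + H - 2c\<close> and \<open>H\<close> the inverse of \<open>G\<close>. The first
  factor changes sign when \<open>G\<close> and \<open>H\<close> are interchanged while \<open>Z\<close> is fixed, and \<open>c\<^sup>2 = 1\<close> gives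
  the factorizations \<open>G - H = H (G + c) (G - c)\<close> and \<open>Z = H (G - c)\<^sup>2\<close>. The symmetry of \<open>M\<close> is
  stated relative to \<open>S\<close> and \<open>J\<close>, both of which interchange \<open>G\<close> and \<open>H\<close>.\<close>

lemma skew_laurent_polynomial:
  fixes G :: "'a::field mat"
  assumes G: "G \<in> carrier_mat n n" and H: "H \<in> carrier_mat n n"
    and GH: "G * H = 1\<^sub>m n" and HG: "H * G = 1\<^sub>m n" and c: "c * c = 1"
    and S: "S \<in> carrier_mat n n" and J: "J \<in> carrier_mat n n"
    and SG: "S * G = H * S" and SH: "S * H = G * S"
    and GJ: "G\<^sup>T * J = J * H" and HJ: "H\<^sup>T * J = J * G"
    and A: "A = G + c \<cdot>\<^sub>m 1\<^sub>m n" and N: "N = G + (- c) \<cdot>\<^sub>m 1\<^sub>m n"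
  shows "\<exists>M U U'. M \<in> carrier_mat n n \<and> U \<in> carrier_mat n n \<and> U' \<in> carrier_mat n n \<and> U' * U = 1\<^sub>m n
     \<and> M = U * (A * N ^\<^sub>m (2 * l + 1)) \<and> S * M = - (M * S) \<and> M\<^sup>T * J = - (J * M)"
proof -
  let ?I = "1\<^sub>m n :: 'a mat"
  note expand = add_mult_distrib_mat[of _ n n _ _ n] mult_add_distrib_mat[of _ n n _ n]
        mult_smult_assoc_mat[of _ n n _ n] mult_smult_distrib[of _ n n _ n]
  have Ac: "A \<in> carrier_mat n n" and Nc: "N \<in> carrier_mat n n"
    and pow: "N ^\<^sub>m k \<in> carrier_mat n n" for k using G A N by auto
  have HN: "H * N = N * H" and HA: "H * A = A * H" using G H GH HG unfolding A N by (simp_all add: expand)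
  have HA': "H * A = ?I + c \<cdot>\<^sub>m H" and HN': "H * N = ?I + (- c) \<cdot>\<^sub>m H"
    using G H HG unfolding A N by (simp_all add: expand)
  have X: "H * (A * N) = G + - H"
  proof -
    have "H * (A * N) = N + c \<cdot>\<^sub>m (H * N)"
      using HA' Ac Nc H by (simp add: expand assoc_mult_mat[of H n n A n N n, symmetric])
    also have "\<dots> = G + - H"
    proof -
      have "c * (c * z) = z" for z using c by (simp flip: mult.assoc)
      then show ?thesis unfolding HN' unfolding N using G H by (intro eq_matI) (auto simp: algebra_simps)
    qed
    finally show ?thesis .
  qed
  define Z where "Z = G + H + (- (c + c)) \<cdot>\<^sub>m ?I"
  have Zc: "Z \<in> carrier_mat n n" using G H by (simp add: Z_def)
  have Z: "H * (N * N) = Z"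
  proof -
    have "H * (N * N) = N + (- c) \<cdot>\<^sub>m (H * N)"
      using HN' Nc H by (simp add: expand assoc_mult_mat[of H n n N n N n, symmetric])
    also have "\<dots> = Z"
    proof -
      have "c * (c * z) = z" for z using c by (simp flip: mult.assoc)
      then show ?thesis unfolding HN' unfolding N Z_def using G H
        by (intro eq_matI) (auto simp: algebra_simps)
    qed
    finally show ?thesis .
  qed
  have Z': "Z = H + G + (- (c + c)) \<cdot>\<^sub>m ?I"
    using comm_add_mat[OF G H] by (simp add: Z_def)
  have SZ: "S * Z = Z * S"
  proof -
    have "S * Z = H * S + G * S + (- (c + c)) \<cdot>\<^sub>m S"
      using S G H SG SH unfolding Z_def by (simp add: expand assoc_add_mat[of _ n n])
    also have "\<dots> = Z * S" using S G H unfolding Z' by (simp add: expand assoc_add_mat[of _ n n])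
    finally show ?thesis .
  qed
  have ZJ: "Z\<^sup>T * J = J * Z"
  proof -
    have "Z\<^sup>T * J = J * H + J * G + (- (c + c)) \<cdot>\<^sub>m J"
      using J G H GJ HJ unfolding Z_def
      by (simp add: expand transpose_add[of _ n n] transpose_smult_mat assoc_add_mat[of _ n n])
    also have "\<dots> = J * Z" using J G H unfolding Z' by (simp add: expand assoc_add_mat[of _ n n])
    finally show ?thesis .
  qed
  have GZ: "G * Z = Z * G" and HZ: "H * Z = Z * H"
    using G H GH HG unfolding Z_def by (simp_all add: expand)
  have "\<exists>M U U'. M \<in> carrier_mat n n \<and> U \<in> carrier_mat n n \<and> U' \<in> carrier_mat n n \<and> U' * U = 1\<^sub>m n
     \<and> M = U * (A * N ^\<^sub>m (2 * l + 1)) \<and> M * Z = Z * M \<and> S * M = - (M * S) \<and> M\<^sup>T * J = - (J * M)"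
  proof (induction l)
    case 0
    have "(G + - H) * Z = Z * (G + - H)"
      using GZ HZ G H Zc by (simp add: expand)
    moreover
    have "S * (G + - H) = - ((G + - H) * S)"
      using S G H SG SH by (simp add: expand, intro eq_matI) auto
    moreover have "(G + - H)\<^sup>T * J = - (J * (G + - H))"
      using J G H GJ HJ by (simp add: expand transpose_add[of _ n n] transpose_uminus, intro eq_matI) auto
    ultimately show ?case using G H X GH Nc by (intro exI[of _ "G + - H"] exI[of _ H] exI[of _ G]) simp
  next
    case (Suc l)
    define Y where "Y = A * N ^\<^sub>m (2 * l + 1)"
    obtain M U U' where M: "M \<in> carrier_mat n n" and U: "U \<in> carrier_mat n n" "U' \<in> carrier_mat n n" "U' * U = ?I"
      and MU: "M = U * Y" and comm: "M * Z = Z * M" and SM: "S * M = - (M * S)" and MJ: "M\<^sup>T * J = - (J * M)"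
      using Suc.IH unfolding Y_def by blast
    have Yc: "Y \<in> carrier_mat n n" unfolding Y_def using Ac pow by (rule mult_carrier_mat)
    have HY: "H * Y = Y * H"
    proof -
      define T where "T = N ^\<^sub>m (2 * l + 1)"
      have T: "T \<in> carrier_mat n n" and HT: "H * T = T * H"
        using pow pow_mat_commute[OF H Nc HN] by (simp_all only: T_def)
      have "H * (A * T) = (H * A) * T" using assoc_mult_mat[OF H Ac T] by simp
      also have "\<dots> = A * (H * T)" unfolding HA using assoc_mult_mat[OF Ac H T] .
      also have "\<dots> = (A * T) * H" unfolding HT using assoc_mult_mat[OF Ac T H] by simp
      finally show ?thesis unfolding Y_def T_def .
    qed
    have "M * Z = U * ((Y * H) * (N * N))"
      using U Yc H Nc unfolding MU Z[symmetric] by (simp add: assoc_mult_mat[of _ n n _ n _ n])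
    also have "\<dots> = (U * H) * (Y * (N * N))"
      using U Yc H Nc unfolding HY[symmetric] by (simp add: assoc_mult_mat[of _ n n _ n _ n])
    also have "Y * (N * N) = A * N ^\<^sub>m (2 * Suc l + 1)"
    proof -
      have "N ^\<^sub>m (2 * Suc l + 1) = N ^\<^sub>m (2 * l + 1) * N * N" by simp
      also have "\<dots> = N ^\<^sub>m (2 * l + 1) * (N * N)" by (rule assoc_mult_mat[OF pow Nc Nc])
      finally show ?thesis
        unfolding Y_def by (simp only: assoc_mult_mat[OF Ac pow mult_carrier_mat[OF Nc Nc]])
    qed
    finally have MZ: "M * Z = (U * H) * (A * N ^\<^sub>m (2 * Suc l + 1))" .
    have inv: "(G * U') * (U * H) = ?I"
    proof -
      have "(G * U') * (U * H) = G * ((U' * U) * H)"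
        using G H U(1,2) by (simp add: assoc_mult_mat[of _ n n _ n _ n])
      then show ?thesis using U(3) GH H by simp
    qed
    have "S * (M * Z) = (S * M) * Z" using S M Zc by simp
    also have "\<dots> = - (M * (S * Z))" using S M Zc unfolding SM by simp
    also have "\<dots> = - (M * Z * S)" using S M Zc unfolding SZ by simp
    finally have 1: "S * (M * Z) = - (M * Z * S)" .
    have "M * Z * Z = Z * M * Z" by (simp only: comm)
    then have 3: "M * Z * Z = Z * (M * Z)" unfolding assoc_mult_mat[OF Zc M Zc] .
    have "(M * Z)\<^sup>T * J = M\<^sup>T * (Z\<^sup>T * J)"
      using M Zc J unfolding comm by (simp add: transpose_mult[of _ n n _ n])
    also have "\<dots> = (M\<^sup>T * J) * Z" using M J Zc unfolding ZJ by simp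
    also have "\<dots> = - (J * (M * Z))" using M J Zc unfolding MJ by simp
    finally have 2: "(M * Z)\<^sup>T * J = - (J * (M * Z))" .
    show ?case
      using MZ inv 1 2 3 mult_carrier_mat[OF M Zc] mult_carrier_mat[OF U(1) H] mult_carrier_mat[OF G U(2)]
      by blast
  qed
  then show ?thesis by blast
qed

text \<open>For odd \<open>j\<close> the nullity of \<open>(G - c)\<^sup>j\<close> is congruent modulo 2 to that of \<open>G + c\<close>, hence
  independent of \<open>j\<close> modulo 2. The nullities at \<open>k - 1\<close> and \<open>k + 1\<close> therefore cancel modulo 2 in the
  formula for the number of blocks.\<close>

lemma even_jordan_blocks:
  fixes G :: "'a::field mat"
  assumes two: "(2 :: 'a) \<noteq> 0" and n: "even n"
    and G: "G \<in> carrier_mat n n" and H: "H \<in> carrier_mat n n" and HG: "H * G = 1\<^sub>m n"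
    and S: "S \<in> carrier_mat n n" and SS: "S * S = 1\<^sub>m n" and SGS: "S * G * S = H"
    and J: "J \<in> carrier_mat n n" and K: "K \<in> carrier_mat n n" "K * J = 1\<^sub>m n" and JT: "J\<^sup>T = - J"
    and GJ: "G\<^sup>T * J * G = J" and SJ: "S\<^sup>T * J * S = J"
    and c: "c * c = 1" and k: "even k" "k > 0" and js: "jordan_nf G js"
  shows "even (count_list js (k, c))"
proof -
  note assoc = assoc_mult_mat[of _ n n _ n _ n]
  have GH: "G * H = 1\<^sub>m n" using mat_mult_left_right_inverse[OF H G HG] .
  have "H * S = S * G * (S * S)" using S G by (simp add: SGS[symmetric] assoc)
  then have SG: "S * G = H * S" using S G SS by simp
  have "S * H = (S * S) * (G * S)" using S G by (simp add: SGS[symmetric] assoc)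
  then have SH: "S * H = G * S" using S G SS by simp
  have "G\<^sup>T * J * (G * H) = (G\<^sup>T * J * G) * H" using G H J by (simp add: assoc)
  then have GJ': "G\<^sup>T * J = J * H" unfolding GH GJ using G J by simp
  have "H\<^sup>T * (G\<^sup>T * J) = (G * H)\<^sup>T * J" using G H J by (simp add: transpose_mult[of _ n n _ n] assoc)
  then have "H\<^sup>T * J * H = J" using GH GJ' H J by (simp add: assoc)
  moreover have "H\<^sup>T * J * (H * G) = (H\<^sup>T * J * H) * G" using G H J by (simp add: assoc)
  ultimately have HJ: "H\<^sup>T * J = J * G" unfolding HG using H J by simp
  have "S\<^sup>T * J * (S * S) = (S\<^sup>T * J * S) * S" using S J by (simp add: assoc)
  then have SJ': "S\<^sup>T * J = J * S" unfolding SS SJ using S J by simp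
  define A where "A = G + c \<cdot>\<^sub>m 1\<^sub>m n"
  have N: "char_matrix G c = G + (- c) \<cdot>\<^sub>m 1\<^sub>m n" using G by (simp add: char_matrix_def)
  have Nc: "char_matrix G c \<in> carrier_mat n n" and Ac: "A \<in> carrier_mat n n" using G by (simp_all add: A_def)
  have AN: "A = char_matrix G c + (c + c) \<cdot>\<^sub>m 1\<^sub>m n"
    unfolding A_def N using G by (intro eq_matI) auto
  have cc: "c + c \<noteq> 0"
  proof
    assume "c + c = 0"
    then have "(c + c) * c = 0" by simp
    then show False using c two by (simp add: algebra_simps)
  qed
  have even: "even (kernel_dim A + dim_gen_eigenspace G c (2 * l + 1))" for l
  proof -
    let ?Y = "A * char_matrix G c ^\<^sub>m (2 * l + 1)"
    obtain M U U' where M: "M \<in> carrier_mat n n" and U: "U \<in> carrier_mat n n" "U' \<in> carrier_mat n n" "U' * U = 1\<^sub>m n"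
      and MU: "M = U * ?Y" and SM: "S * M = - (M * S)" and MJ: "M\<^sup>T * J = - (J * M)"
      using skew_laurent_polynomial[OF G H GH HG c S J SG SH GJ' HJ A_def N, of l] by blast
    have "even (kernel_dim M)"
      using even_kernel_dim_skew[OF two n M S J K SS SJ' JT SM MJ] .
    moreover have "kernel_dim M = kernel_dim ?Y"
      unfolding MU by (rule kernel_dim_mult_left[OF _ U]) (use Ac Nc in auto)
    ultimately show ?thesis
      using kernel_dim_shift_mult_pow[OF Nc AN cc, of "2 * l + 1"] by (simp add: dim_gen_eigenspace_def)
  qed
  obtain l where l: "k = 2 * l + 2" using k by (elim evenE) (metis add_2_eq_Suc' gr0_implies_Suc mult_Suc_right add.commute nat_0_less_mult_iff)
  have "even (dim_gen_eigenspace G c (k - 1) + dim_gen_eigenspace G c (Suc k))"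
    using even[of l] even[of "Suc l"] l by simp
  then have "even (compute_nr_of_jordan_blocks G c k)"
    unfolding compute_nr_of_jordan_blocks_def by presburger
  moreover have "count_list l x = length (filter ((=) x) l)" for l :: "(nat \<times> 'a) list" and x
    by (induction l) auto
  ultimately show ?thesis using compute_nr_of_jordan_blocks[OF js] k by simp
qed

section \<open>Gram matrices and isometries\<close>

definition gram_matrix :: "nat \<Rightarrow> ('a::field vec \<Rightarrow> 'a vec \<Rightarrow> 'a) \<Rightarrow> 'a mat" where
  "gram_matrix m B = mat m m (\<lambda>(i, j). B (unit_vec m i) (unit_vec m j))"

lemma gram_matrix_carrier [simp]: "gram_matrix m B \<in> carrier_mat m m"
  by (simp add: gram_matrix_def)

lemma linear_functional_expand:
  fixes f :: "'a::field vec \<Rightarrow> 'a"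
  assumes add: "\<And>u v. u \<in> carrier_vec m \<Longrightarrow> v \<in> carrier_vec m \<Longrightarrow> f (u + v) = f u + f v"
    and smult: "\<And>a v. v \<in> carrier_vec m \<Longrightarrow> f (a \<cdot>\<^sub>v v) = a * f v"
    and v: "v \<in> carrier_vec m"
  shows "f v = (\<Sum>i<m. v $ i * f (unit_vec m i))"
proof -
  define t where "t k = vec m (\<lambda>i. if i < k then v $ i else 0)" for k
  have tc: "t k \<in> carrier_vec m" for k by (simp add: t_def)
  have "f (t k) = (\<Sum>i<k. v $ i * f (unit_vec m i))" if "k \<le> m" for k
    using that
  proof (induction k)
    case 0
    have "t 0 = 0 \<cdot>\<^sub>v t 0" by (auto simp: t_def)
    then have "f (t 0) = 0" using smult[OF tc, of 0 0] by simp
    then show ?case by simp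
  next
    case (Suc k)
    have "t (Suc k) = t k + v $ k \<cdot>\<^sub>v unit_vec m k"
      using Suc.prems by (intro eq_vecI) (auto simp: t_def less_Suc_eq)
    then show ?case using Suc add[OF tc, of "v $ k \<cdot>\<^sub>v unit_vec m k" k] smult by simp
  qed
  moreover have "t m = v" using v by (intro eq_vecI) (auto simp: t_def)
  ultimately show ?thesis by auto
qed

lemma gram_matrix_form:
  assumes B: "bilinear_form m B" and u: "u \<in> carrier_vec m" and v: "v \<in> carrier_vec m"
  shows "B u v = u \<bullet> (gram_matrix m B *\<^sub>v v)"
proof -
  have "B u v = (\<Sum>i<m. u $ i * B (unit_vec m i) v)"
    by (rule linear_functional_expand[of m "\<lambda>u. B u v"]) (use B u v in \<open>auto simp: bilinear_form_def\<close>)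
  also have "\<dots> = (\<Sum>i<m. u $ i * (gram_matrix m B *\<^sub>v v) $ i)"
  proof (rule sum.cong)
    fix i assume "i \<in> {..<m}"
    then have i: "i < m" by simp
    have "B (unit_vec m i) v = (\<Sum>j<m. v $ j * B (unit_vec m i) (unit_vec m j))"
      by (rule linear_functional_expand[of m "B (unit_vec m i)"]) (use B v in \<open>auto simp: bilinear_form_def\<close>)
    also have "\<dots> = (gram_matrix m B *\<^sub>v v) $ i"
      using i v by (simp add: gram_matrix_def scalar_prod_def lessThan_atLeast0 mult.commute)
    finally show "u $ i * B (unit_vec m i) v = u $ i * (gram_matrix m B *\<^sub>v v) $ i" by simp
  qed simp
  finally show ?thesis by (simp add: scalar_prod_def lessThan_atLeast0 gram_matrix_def)
qed

lemma gram_matrix_isometry: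
  assumes B: "bilinear_form m B" and g: "g \<in> carrier (isometry_group m B)"
  shows "g\<^sup>T * gram_matrix m B * g = gram_matrix m B"
proof -
  let ?J = "gram_matrix m B"
  have gc: "g \<in> carrier_mat m m"
    and iso: "\<And>v w. v \<in> carrier_vec m \<Longrightarrow> w \<in> carrier_vec m \<Longrightarrow> B (g *\<^sub>v v) (g *\<^sub>v w) = B v w"
    using g by (auto simp: isometry_group_def)
  have "(g\<^sup>T * (?J * g)) $$ (i, j) = ?J $$ (i, j)" if ij: "i < m" "j < m" for i j
  proof -
    have "(g\<^sup>T * (?J * g)) $$ (i, j) = col g i \<bullet> (?J *\<^sub>v col g j)"
      using ij gc by (simp add: gram_matrix_def col_mult2[of _ m m _ m])
    also have "\<dots> = B (col g i) (col g j)"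
      using gram_matrix_form[OF B, of "col g i" "col g j"] ij gc by simp
    also have "\<dots> = B (g *\<^sub>v unit_vec m i) (g *\<^sub>v unit_vec m j)"
    proof -
      have "g *\<^sub>v unit_vec m l = col g l" if "l < m" for l
        using that gc by (intro eq_vecI) auto
      then show ?thesis using ij by simp
    qed
    finally show ?thesis using ij iso by (simp add: gram_matrix_def)
  qed
  then have "g\<^sup>T * (?J * g) = ?J" using gc by (intro eq_matI) (auto simp: gram_matrix_def)
  then show ?thesis using gc by (simp add: assoc_mult_mat[of _ m m _ m _ m])
qed

lemma gram_matrix_alternating:
  assumes "alternating_form m B"
  shows "(gram_matrix m B)\<^sup>T = - gram_matrix m B"
proof -
  have B: "bilinear_form m B" and alt: "\<And>v. v \<in> carrier_vec m \<Longrightarrow> B v v = 0"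
    using assms by (auto simp: alternating_form_def)
  have anti: "B u v = - B v u" if u: "u \<in> carrier_vec m" and v: "v \<in> carrier_vec m" for u v
  proof -
    have "B (u + v) (u + v) = B u u + B u v + (B v u + B v v)"
      using B u v by (simp add: bilinear_form_def)
    then show ?thesis using alt u v by (simp add: eq_neg_iff_add_eq_0)
  qed
  show ?thesis
  proof (rule eq_matI)
    fix i j assume "i < dim_row (- gram_matrix m B)" "j < dim_col (- gram_matrix m B)"
    then show "(gram_matrix m B)\<^sup>T $$ (i, j) = (- gram_matrix m B) $$ (i, j)"
      using anti[of "unit_vec m j" "unit_vec m i"] by (simp add: gram_matrix_def)
  qed (simp_all add: gram_matrix_def)
qed

lemma gram_matrix_invertible:
  assumes B: "bilinear_form m B" and nd: "nondegenerate_form m B"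
  shows "\<exists>K\<in>carrier_mat m m. K * gram_matrix m B = 1\<^sub>m m"
proof -
  let ?J = "gram_matrix m B"
  have "det ?J \<noteq> 0"
  proof
    assume "det ?J = 0"
    then obtain v where v: "v \<in> carrier_vec m" "v \<noteq> 0\<^sub>v m" "?J *\<^sub>v v = 0\<^sub>v m"
      using det_0_iff_vec_prod_zero[of ?J m] by auto
    then have "B u v = 0" if "u \<in> carrier_vec m" for u
      using gram_matrix_form[OF B that v(1)] that by simp
    then show False using nd v unfolding nondegenerate_form_def by blast
  qed
  then show ?thesis
    using det_non_zero_imp_unit[of ?J m "()"] by (auto simp: Units_def ring_mat_def)
qed

section \<open>Strongly real elements of the symplectic group\<close>

text \<open>Translation by 1 permutes the field, so summing all elements shows that the number of elements
  vanishes in the field. If 2 vanished as well, an odd number of elements would force \<open>1 = 0\<close>.\<close>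

lemma two_neq_zero_of_odd_card:
  assumes "odd (card (UNIV :: 'a::{field,finite} set))"
  shows "(2 :: 'a) \<noteq> 0"
proof
  assume two: "(2 :: 'a) = 0"
  let ?q = "card (UNIV :: 'a set)"
  have "(\<Sum>x\<in>UNIV. x) = (\<Sum>x\<in>UNIV. x + 1 :: 'a)"
    by (rule sum.reindex_bij_witness[of _ "\<lambda>x. x + 1" "\<lambda>x. x - 1"]) auto
  then have "(of_nat ?q :: 'a) = 0" by (simp add: sum.distrib)
  moreover obtain k where "?q = 2 * k + 1" using assms by (rule oddE)
  ultimately show False using two by simp
qed

interpretation to_ac: field_hom "to_ac :: 'a::field \<Rightarrow> 'a alg_closure"
  by unfold_locales auto

text \<open>The relations between \<open>g\<close>, the involution and the Gram matrix are polynomial identities in the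
  entries, so they persist over the algebraic closure.\<close>

lemma strongly_real_even_elem_divisor_mult:
  fixes B :: "'a::field vec \<Rightarrow> 'a vec \<Rightarrow> 'a"
  assumes two: "(2 :: 'a) \<noteq> 0" and m: "even m"
    and alt: "alternating_form m B" and nd: "nondegenerate_form m B"
    and real: "strongly_real (isometry_group m B) g"
    and c: "c * c = 1" and k: "even k" "k > 0"
  shows "even (elem_divisor_mult g c k)"
proof -
  let ?G = "isometry_group m B" and ?J = "gram_matrix m B"
  let ?h = "map_mat (to_ac :: 'a \<Rightarrow> 'a alg_closure)"
  interpret Sp: group ?G by (rule group_isometry_group)
  have B: "bilinear_form m B" using alt by (simp add: alternating_form_def)
  obtain s where g: "g \<in> carrier ?G" and s: "s \<in> carrier ?G"
    and ss: "s \<otimes>\<^bsub>?G\<^esub> s = \<one>\<^bsub>?G\<^esub>" and sgs: "s \<otimes>\<^bsub>?G\<^esub> g \<otimes>\<^bsub>?G\<^esub> s = inv\<^bsub>?G\<^esub> g"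
    using real by (auto simp: strongly_real_def)
  define h where "h = inv\<^bsub>?G\<^esub> g"
  have h: "h \<in> carrier ?G" and hg: "h \<otimes>\<^bsub>?G\<^esub> g = \<one>\<^bsub>?G\<^esub>" using g by (simp_all add: h_def)
  have carr: "g \<in> carrier_mat m m" "h \<in> carrier_mat m m" "s \<in> carrier_mat m m"
    using g h s by (auto simp: isometry_group_def)
  have eqs: "h * g = 1\<^sub>m m" "s * s = 1\<^sub>m m" "s * g * s = h"
    using hg ss sgs by (simp_all add: isometry_group_def h_def)
  obtain K where K: "K \<in> carrier_mat m m" "K * ?J = 1\<^sub>m m"
    using gram_matrix_invertible[OF B nd] by blast
  obtain js where js: "jordan_nf (?h g) js" using jordan_nf_to_ac_exists[OF carr(1)] by blast
  note hom = to_ac.mat_hom_mult[of _ m m _ m]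
  have "even (count_list js (k, to_ac c))"
  proof (rule even_jordan_blocks[OF _ m, of "?h g" "?h h" "?h s" "?h ?J" "?h K"])
    show "(2 :: 'a alg_closure) \<noteq> 0" using two to_ac_eq_0_iff[of "2 :: 'a"] by simp
    show "?h h * ?h g = 1\<^sub>m m" "?h s * ?h s = 1\<^sub>m m" "?h s * ?h g * ?h s = ?h h"
      "?h K * ?h ?J = 1\<^sub>m m"
      using carr K eqs by (simp_all add: hom[symmetric] to_ac.mat_hom_one)
    have "?h (- ?J) = - ?h ?J" by (rule eq_matI) auto
    then show "(?h ?J)\<^sup>T = - ?h ?J"
      using arg_cong[OF gram_matrix_alternating[OF alt], of ?h]
      by (auto simp: map_mat_transpose)
    show "(?h g)\<^sup>T * ?h ?J * ?h g = ?h ?J" "(?h s)\<^sup>T * ?h ?J * ?h s = ?h ?J"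
      using arg_cong[OF gram_matrix_isometry[OF B g], of ?h]
        arg_cong[OF gram_matrix_isometry[OF B s], of ?h] carr
      by (simp_all add: map_mat_transpose hom)
    show "to_ac c * to_ac c = 1" using c to_ac_mult[of c c] by simp
  qed (use carr K js k in auto)
  then show ?thesis using elem_divisor_mult_eq[OF js] by simp
qed

theorem corollary5p1:
  fixes B :: "'a::{field,finite} vec \<Rightarrow> 'a vec \<Rightarrow> 'a"
    and p r q n :: nat
    and C :: "'a mat set"
  assumes "prime p" and "odd p" and "r \<ge> 1" and "q = p ^ r"
    and "card (UNIV :: 'a set) = q"
    and "n \<ge> 1"
    and "alternating_form (2 * n) B" and "nondegenerate_form (2 * n) B"
    and "C \<in> conjugacy_classes (isometry_group (2 * n) B)"
    and "\<exists>i>0. (\<forall>g\<in>C. odd (elem_divisor_mult g 1 (2 * i))) \<or>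
               (\<forall>g\<in>C. odd (elem_divisor_mult g (- 1) (2 * i)))"
  shows "\<not> strongly_real_class (isometry_group (2 * n) B) C"
proof
  let ?G = "isometry_group (2 * n) B"
  assume "strongly_real_class ?G C"
  moreover obtain g where g: "g \<in> C"
  proof -
    interpret group ?G by (rule group_isometry_group)
    show ?thesis
      using that one_closed \<open>C \<in> conjugacy_classes ?G\<close>
      by (auto simp: conjugacy_classes_def orbits_def orbit_def)
  qed
  ultimately have real: "strongly_real ?G g" by (simp add: strongly_real_class_def)
  have two: "(2 :: 'a) \<noteq> 0"
    using two_neq_zero_of_odd_card[where ?'a = 'a] assms(2,4,5) by simp
  have "even (elem_divisor_mult g c (2 * i))" if "i > 0" "c * c = 1" for i c
    using strongly_real_even_elem_divisor_mult[OF two _ assms(7,8) real that(2), of "2 * i"] that(1)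
    by simp
  from this[of _ 1] this[of _ "- 1"] g assms(10) show False by auto
qed

end
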